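(* (1) Let $(\rho,u_1,u_2,u_3)$ be a smooth solution of the steady isentropic compressible Euler system $$ \partial_1(\rho u_1)+\partial_2(\rho u_2)+\partial_3(\rho u_3)=0,\qquad \sum_{j=1}^3\partial_j(\rho u_iu_j)+\partial_i p=0\quad(i=1,2,3), $$ with $p=\frac1\gamma\rho^\gamma$, $\rho>0$, $u_1>0$ and $|\mathbf{u}|\ge\delta$ for some constant $\delta>0$. If the Bernoulli function $B$ is constant throughout the flow region, then, with $\mathbf{A}=(A_1,A_2,A_3)=\frac{1}{I(\rho)}(K_1,K_2,K_3)$, $$ \begin{aligned} &\operatorname{div}(\rho\mathbf{A})=0,\\ &\partial_1(\rho A_1^2)+\partial_2(\rho A_1A_2)+\partial_3(\rho A_1A_3)+\partial_1Q(\rho)=0,\\ &\partial_1(\rho A_1A_2)+\partial_2(\rho A_2^2)+\partial_3(\rho A_2A_3)+\partial_2Q(\rho)=0,\\ &\partial_1(\rho A_1A_3)+\partial_2(\rho A_2A_3)+\partial_3(\rho A_3^2)+\partial_3Q(\rho)=0 . \end{aligned} $$ (2) For a general smooth solution of the same isentropic system with $\rho>0$, $u_1>0$, $|\mathbf{u}|\ge\delta>0$ ($B$ not necessarily constant), $$ \partial_1\Big(\rho\frac{K_1}{I(\rho,B)}\Big)+\partial_2\Big(\rho\frac{K_2}{I(\rho,B)}\Big)+\partial_3\Big(\rho\frac{K_3}{I(\rho,B)}\Big)=0 . $$ (3) For a smooth solution $(\rho,u_1,u_2,u_3,S)$ of the steady non-isentropic Euler equations with $\rho>0$, $u_1>0$,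 $|\mathbf{u}|\ge\delta>0$, $$ \partial_1\Big(\rho\frac{K_1}{I(\rho,B,S)}\Big)+\partial_2\Big(\rho\frac{K_2}{I(\rho,B,S)}\Big)+\partial_3\Big(\rho\frac{K_3}{I(\rho,B,S)}\Big)=0 . $$
   Context: Notation: $\partial_i=\partial_{x_i}$, $\mathbf{u}=(u_1,u_2,u_3)$ is the velocity, $\rho$ the density. Put $\beta_2=u_2/u_1$, $\beta_3=u_3/u_1$, $G=1+\beta_2^2+\beta_3^2$, $K_1=G^{-1/2}$, $K_i=\beta_iG^{-1/2}$ for $i=2,3$. Isentropic case: $p(\rho)=\frac1\gamma\rho^\gamma$ with $\gamma\in(1,3)$, $c^2(\rho)=p'(\rho)$, $h$ is the enthalpy with $h'(\rho)=c^2(\rho)/\rho$ and $h(0)=0$, and $B=\frac12|\mathbf{u}|^2+h(\rho)$ is the Bernoulli function. When $B$ is constant, $$I(\rho)=\exp\Big(\int_0^\rho\frac{c^2(t)}{2t(B-h(t))}\,dt\Big),\qquad Q(\rho)=\int_0^\rho\frac{c^2(t)}{2(B-h(t))}\,I(t)^{-2}\,dt .$$ For general $B$, $I(\rho,B)=\exp\Big(\int_0^\rho\frac{c^2(t)}{2t(B-h(t))}\,dt\Big)$, where at each point $x$ the number $B=B(x)$ is held fixed in the integral. Non-isentropic case: $S$ is the entropy and $P=P(\rho,S)$ is the pressure of an ideal polytropic gas, $P(\rho,S)=a(S)\rho^\gamma$ with $a$ a positive smooth function and $\gamma\in(1,3)$; the enthalpy is $h(\rho,S)=\int_0^\rho\frac{\partial_\rho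 P(\tau,S)}{\tau}\,d\tau$ and the Bernoulli function is $B=\frac12|\mathbf{u}|^2+h(\rho,S)$. The steady non-isentropic Euler equations are $$\operatorname{div}(\rho\mathbf{u})=0,\qquad \rho(\mathbf{u}\cdot\nabla)\mathbf{u}+\nabla P=0,\qquad \mathbf{u}\cdot\nabla B=0,\qquad \mathbf{u}\cdot\nabla S=0 .$$ Moreover $I(\rho,B,S)=\exp\Big(\int_0^\rho\frac{\partial_\rho P(t,S)}{2t(B-h(t,S))}\,dt\Big)$, with $B=B(x)$ and $S=S(x)$ held fixed in the integral. *)

theory Defs
  imports "HOL-Analysis.Analysis"
begin

section \<open>Smooth functions and classical differential operators\<close>

text \<open>Meant for open sets, where differentiability within the set is differentiability.\<close>

primrec Ck_on :: "nat \<Rightarrow> 'a::euclidean_space set \<Rightarrow> ('a \<Rightarrow> 'b::real_normed_vector) \<Rightarrow> bool" where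
  "Ck_on 0 X f = continuous_on X f"
| "Ck_on (Suc k) X f =
     (f differentiable_on X \<and> (\<forall>b\<in>Basis. Ck_on k X (\<lambda>x. frechet_derivative f (at x) b)))"

definition smooth_on :: "'a::euclidean_space set \<Rightarrow> ('a \<Rightarrow> 'b::real_normed_vector) \<Rightarrow> bool" where
  "smooth_on X f \<longleftrightarrow> (\<forall>k. Ck_on k X f)"

definition partial :: "3 \<Rightarrow> (real^3 \<Rightarrow> real) \<Rightarrow> real^3 \<Rightarrow> real" where
  "partial i f x = deriv (\<lambda>t. f (x + t *\<^sub>R axis i 1)) 0"

definition divg :: "(real^3 \<Rightarrow> real^3) \<Rightarrow> real^3 \<Rightarrow> real" where
  "divg V x = (\<Sum>i\<in>UNIV. partial i (\<lambda>y. V y $ i) x)"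

text \<open>The transport operator \<open>(u \<cdot> \<nabla>) f\<close>.\<close>

definition transport :: "(real^3 \<Rightarrow> real^3) \<Rightarrow> (real^3 \<Rightarrow> real) \<Rightarrow> real^3 \<Rightarrow> real" where
  "transport u f x = (\<Sum>j\<in>UNIV. u x $ j * partial j f x)"

section \<open>Thermodynamics of a pressure law\<close>

text \<open>
  In this section \<open>P\<close> is a pressure law \<open>\<rho> \<mapsto> P(\<rho>)\<close>.  In the non-isentropic case it is the law
  \<open>P(\<cdot>,S)\<close> at a frozen value of the entropy, so that \<open>sound2\<close> is the partial derivative of the
  pressure with respect to the density.  The integrals are Henstock-Kurzweil integrals; they are
  improper at \<open>0\<close> when \<open>\<gamma> < 2\<close>, and the value of the integrand at \<open>0\<close> is immaterial.
\<close>

definition isentropic_law :: "real \<Rightarrow> real \<Rightarrow> real" where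
  "isentropic_law \<gamma> = (\<lambda>\<rho>. 1 / \<gamma> * \<rho> powr \<gamma>)"

definition polytropic_law :: "real \<Rightarrow> (real \<Rightarrow> real) \<Rightarrow> real \<Rightarrow> real \<Rightarrow> real" where
  "polytropic_law \<gamma> a S = (\<lambda>\<rho>. a S * \<rho> powr \<gamma>)"

definition sound2 :: "(real \<Rightarrow> real) \<Rightarrow> real \<Rightarrow> real" where
  "sound2 P \<rho> = deriv P \<rho>"

definition enthalpy :: "(real \<Rightarrow> real) \<Rightarrow> real \<Rightarrow> real" where
  "enthalpy P \<rho> = integral {0..\<rho>} (\<lambda>t. sound2 P t / t)"

definition bernoulli :: "(real \<Rightarrow> real) \<Rightarrow> real \<Rightarrow> real^3 \<Rightarrow> real" where
  "bernoulli P \<rho> v = 1/2 * (norm v)\<^sup>2 + enthalpy P \<rho>"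

definition I_factor :: "(real \<Rightarrow> real) \<Rightarrow> real \<Rightarrow> real \<Rightarrow> real" where
  "I_factor P B \<rho> = exp (integral {0..\<rho>} (\<lambda>t. sound2 P t / (2 * t * (B - enthalpy P t))))"

definition Q_pressure :: "(real \<Rightarrow> real) \<Rightarrow> real \<Rightarrow> real \<Rightarrow> real" where
  "Q_pressure P B \<rho> =
     integral {0..\<rho>} (\<lambda>t. sound2 P t / (2 * (B - enthalpy P t)) * (I_factor P B t) powi (-2))"

text \<open>
  The isentropic enthalpy satisfies \<open>h(0) = 0\<close> and \<open>h' = c\<^sup>2/\<rho>\<close>; together with
  continuity at \<open>0\<close> this determines it on \<open>[0,\<infinity>)\<close>.
\<close>

lemma sound2_isentropic: "0 < \<gamma> \<Longrightarrow> 0 < t \<Longrightarrow> sound2 (isentropic_law \<gamma>) t = t powr (\<gamma> - 1)"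
  unfolding sound2_def isentropic_law_def
  by (rule DERIV_imp_deriv) (auto intro!: derivative_eq_intros)

lemma powr_primitive:
  assumes "1 < \<gamma>" "0 < t"
  shows "((\<lambda>t. t powr (\<gamma> - 1) / (\<gamma> - 1)) has_real_derivative
            sound2 (isentropic_law \<gamma>) t / t) (at t)"
proof -
  have "((\<lambda>t. t powr (\<gamma> - 1) / (\<gamma> - 1)) has_real_derivative
            ((\<gamma> - 1) * t powr (\<gamma> - 1 - 1)) / (\<gamma> - 1)) (at t)"
    using assms by (intro DERIV_cdivide has_real_derivative_powr) auto
  moreover have "((\<gamma> - 1) * t powr (\<gamma> - 1 - 1)) / (\<gamma> - 1) = sound2 (isentropic_law \<gamma>) t / t"
    using assms by (simp add: sound2_isentropic powr_diff power2_eq_square)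
  ultimately show ?thesis by simp
qed

lemma enthalpy_isentropic:
  assumes "1 < \<gamma>" "0 \<le> \<rho>"
  shows "enthalpy (isentropic_law \<gamma>) \<rho> = \<rho> powr (\<gamma> - 1) / (\<gamma> - 1)"
proof -
  let ?F = "\<lambda>t::real. t powr (\<gamma> - 1) / (\<gamma> - 1)"
  have "((\<lambda>t. sound2 (isentropic_law \<gamma>) t / t) has_integral (?F \<rho> - ?F 0)) {0..\<rho>}"
  proof (rule fundamental_theorem_of_calculus_interior)
    show "continuous_on {0..\<rho>} ?F"
      using assms by (intro continuous_intros continuous_on_powr') auto
    fix t assume t: "t \<in> {0<..<\<rho>}"
    show "(?F has_vector_derivative sound2 (isentropic_law \<gamma>) t / t) (at t)"
      using powr_primitive[of \<gamma> t] assms t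
      by (simp add: has_real_derivative_iff_has_vector_derivative)
  qed (use assms in auto)
  then show ?thesis
    unfolding enthalpy_def by (simp add: integral_unique)
qed

lemma enthalpy_isentropic_0: "1 < \<gamma> \<Longrightarrow> enthalpy (isentropic_law \<gamma>) 0 = 0"
  by (simp add: enthalpy_isentropic)

lemma enthalpy_isentropic_deriv:
  assumes "1 < \<gamma>" "0 < \<rho>"
  shows "(enthalpy (isentropic_law \<gamma>) has_real_derivative sound2 (isentropic_law \<gamma>) \<rho> / \<rho>) (at \<rho>)"
proof (rule has_field_derivative_transform_within_open)
  show "((\<lambda>t. t powr (\<gamma> - 1) / (\<gamma> - 1)) has_real_derivative sound2 (isentropic_law \<gamma>) \<rho> / \<rho>) (at \<rho>)"
    using powr_primitive assms .
  show "open {0::real<..}" by simp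
qed (use assms in \<open>auto simp: enthalpy_isentropic\<close>)

section \<open>The flow direction\<close>

definition G_factor :: "real^3 \<Rightarrow> real" where
  "G_factor v = 1 + (v $ 2 / v $ 1)\<^sup>2 + (v $ 3 / v $ 1)\<^sup>2"

definition K_dir :: "real^3 \<Rightarrow> real^3" where
  "K_dir v = vector [G_factor v powr (-1/2),
                     v $ 2 / v $ 1 * G_factor v powr (-1/2),
                     v $ 3 / v $ 1 * G_factor v powr (-1/2)]"

section \<open>Euler systems\<close>

text \<open>The conservation form, with a given pressure field \<open>p\<close>.\<close>

definition steady_euler ::
  "(real^3) set \<Rightarrow> (real^3 \<Rightarrow> real) \<Rightarrow> (real^3 \<Rightarrow> real^3) \<Rightarrow> (real^3 \<Rightarrow> real) \<Rightarrow> bool" where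
  "steady_euler \<Omega> \<rho> u p \<longleftrightarrow> (\<forall>x\<in>\<Omega>.
     divg (\<lambda>y. \<rho> y *\<^sub>R u y) x = 0 \<and>
     (\<forall>i. (\<Sum>j\<in>UNIV. partial j (\<lambda>y. \<rho> y * u y $ i * u y $ j) x) + partial i p x = 0))"

definition isentropic_flow ::
  "real \<Rightarrow> (real^3) set \<Rightarrow> (real^3 \<Rightarrow> real) \<Rightarrow> (real^3 \<Rightarrow> real^3) \<Rightarrow> bool" where
  "isentropic_flow \<gamma> \<Omega> \<rho> u \<longleftrightarrow>
     smooth_on \<Omega> \<rho> \<and> smooth_on \<Omega> u \<and> steady_euler \<Omega> \<rho> u (\<lambda>x. isentropic_law \<gamma> (\<rho> x))"

definition nonisentropic_flow ::
  "real \<Rightarrow> (real \<Rightarrow> real) \<Rightarrow> (real^3) set \<Rightarrow> (real^3 \<Rightarrow> real) \<Rightarrow> (real^3 \<Rightarrow> real^3) \<Rightarrow> (real^3 \<Rightarrow> real) \<Rightarrow> bool"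
where
  "nonisentropic_flow \<gamma> a \<Omega> \<rho> u S \<longleftrightarrow>
     smooth_on \<Omega> \<rho> \<and> smooth_on \<Omega> u \<and> smooth_on \<Omega> S \<and>
     (\<forall>x\<in>\<Omega>.
        divg (\<lambda>y. \<rho> y *\<^sub>R u y) x = 0 \<and>
        (\<forall>i. \<rho> x * transport u (\<lambda>y. u y $ i) x
              + partial i (\<lambda>y. polytropic_law \<gamma> a (S y) (\<rho> y)) x = 0) \<and>
        transport u (\<lambda>y. bernoulli (polytropic_law \<gamma> a (S y)) (\<rho> y) (u y)) x = 0 \<and>
        transport u S x = 0)"

text \<open>
  A classical solution: differentiability is part of the claim, because \<^const>\<open>deriv\<close> is total
  and has an unspecified value where no derivative exists.
\<close>

definition divergence_free_on :: "(real^3) set \<Rightarrow> (real^3 \<Rightarrow> real^3) \<Rightarrow> bool" where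
  "divergence_free_on \<Omega> V \<longleftrightarrow> V differentiable_on \<Omega> \<and> (\<forall>x\<in>\<Omega>. divg V x = 0)"

definition nondegenerate :: "(real^3) set \<Rightarrow> (real^3 \<Rightarrow> real) \<Rightarrow> (real^3 \<Rightarrow> real^3) \<Rightarrow> bool" where
  "nondegenerate \<Omega> \<rho> u \<longleftrightarrow>
     (\<forall>x\<in>\<Omega>. \<rho> x > 0 \<and> u x $ 1 > 0) \<and> (\<exists>\<delta>>0. \<forall>x\<in>\<Omega>. norm (u x) \<ge> \<delta>)"

end

theory Submission
  imports Defs
begin

text \<open>
  All three parts rest on the fact that the integrals can be evaluated.  For a pressure law
  \<open>P = k \<rho>\<^sup>\<gamma>\<close> with enthalpy \<open>h\<close>, the exponent of \<open>I\<close> has the integrand \<open>h'/(2(B - h))\<close>, so that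
  \<open>I = sqrt (B/(B - h))\<close>.  By the definition of \<open>B\<close>, the difference \<open>B - h\<close> is the kinetic energy
  \<open>|u|\<^sup>2/2\<close>; hence \<open>1/I = |u|/sqrt (2B)\<close>.  As \<open>u\<^sub>1 > 0\<close>, the vector \<open>K\<close> is the unit vector \<open>u/|u|\<close>,
  and therefore \<open>K/I = u/sqrt (2B)\<close> (lemma \<open>K_over_I\<close>): dividing by \<open>I\<close> merely rescales the velocity.
  In the same way \<open>Q = P/(2B)\<close> (lemma \<open>Q_pressure_power_law\<close>).

  When \<open>B\<close> is constant, \<open>A\<close> and \<open>Q\<close> come from \<open>u\<close> and \<open>p\<close> by multiplication with \<open>c\<close> and \<open>c\<^sup>2\<close>, where
  \<open>c = 1/sqrt (2B)\<close>, and the steady Euler system is invariant under this scaling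
  (lemma \<open>steady_euler_scale\<close>).

  When \<open>B\<close> varies, the claim is that \<open>div (\<rho> u / sqrt (2B)) = 0\<close>.  This follows from
  \<open>div (\<rho> u) = 0\<close> and \<open>u \<cdot> \<nabla>B = 0\<close> (lemma \<open>divergence_free_rescaled_momentum\<close>).  The second identity
  is one of the equations in the non-isentropic system; in the isentropic case it is Bernoulli's
  theorem (lemma \<open>bernoulli_transported\<close>).
\<close>

section \<open>Partial derivatives of differentiable fields\<close>

lemma smooth_on_imp_differentiable_at:
  assumes "smooth_on X f" "open X" "x \<in> X"
  shows "f differentiable (at x)"
proof -
  have "Ck_on (Suc 0) X f"
    using assms(1) unfolding smooth_on_def by blast
  then show ?thesis
    using assms(2,3) by (simp add: differentiable_on_eq_differentiable_at)
qed

text \<open>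
  A partial derivative is a derivative along a line, so this lets the product and chain rules for
  \<^const>\<open>partial\<close> be read off from the Frechet calculus.
\<close>

lemma partial_eq_derivative:
  assumes "(f has_derivative f') (at x)"
  shows "partial i f x = f' (axis i 1)"
proof -
  have line: "((\<lambda>t. x + t *\<^sub>R axis i 1) has_derivative (\<lambda>t. t *\<^sub>R axis i 1)) (at (0::real))"
    by (auto intro!: derivative_eq_intros)
  have "((\<lambda>t. f (x + t *\<^sub>R axis i 1)) has_derivative (\<lambda>t. f' (t *\<^sub>R axis i 1))) (at 0)"
    by (rule has_derivative_compose[OF line]) (simp add: assms)
  moreover have "(\<lambda>t. f' (t *\<^sub>R axis i 1)) = (*) (f' (axis i 1))"
    using linear_scale[OF has_derivative_linear[OF assms]] by (auto simp: mult.commute)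
  ultimately have "((\<lambda>t. f (x + t *\<^sub>R axis i 1)) has_real_derivative f' (axis i 1)) (at 0)"
    by (simp add: has_field_derivative_def)
  then show ?thesis
    unfolding partial_def by (rule DERIV_imp_deriv)
qed

text \<open>
  A short piece of each coordinate line through a point of an open set stays in the set.  Closed
  forms that hold only where \<open>\<rho> > 0\<close> and \<open>u\<^sub>1 > 0\<close> may therefore be substituted under a partial
  derivative.
\<close>

lemma partial_cong:
  assumes "open \<Omega>" "x \<in> \<Omega>" "\<And>y. y \<in> \<Omega> \<Longrightarrow> f y = g y"
  shows "partial i f x = partial i g x"
proof -
  have "((\<lambda>t. x + t *\<^sub>R axis i 1) \<longlongrightarrow> x + 0 *\<^sub>R axis i 1) (nhds (0::real))"
    by (intro tendsto_intros filterlim_ident)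
  then have "\<forall>\<^sub>F t in nhds (0::real). x + t *\<^sub>R axis i 1 \<in> \<Omega>"
    using assms(1,2) by (intro topological_tendstoD) auto
  then have "\<forall>\<^sub>F t in nhds (0::real). f (x + t *\<^sub>R axis i 1) = g (x + t *\<^sub>R axis i 1)"
    by eventually_elim (rule assms(3))
  then show ?thesis
    unfolding partial_def by (intro deriv_cong_ev) auto
qed

lemma divg_cong:
  assumes "open \<Omega>" "x \<in> \<Omega>" "\<And>y. y \<in> \<Omega> \<Longrightarrow> V y = W y"
  shows "divg V x = divg W x"
  unfolding divg_def using assms by (intro sum.cong refl partial_cong[of \<Omega>]) auto

lemma differentiable_cong_open:
  assumes "open \<Omega>" "x \<in> \<Omega>" "\<And>y. y \<in> \<Omega> \<Longrightarrow> f y = g y" "g differentiable (at x)"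
  shows "f differentiable (at x)"
  using assms has_derivative_transform_within_open unfolding differentiable_def by metis

lemma partial_add:
  assumes "f differentiable (at x)" "g differentiable (at x)"
  shows "partial i (\<lambda>y. f y + g y) x = partial i f x + partial i g x"
proof -
  obtain f' g' where d: "(f has_derivative f') (at x)" "(g has_derivative g') (at x)"
    using assms unfolding differentiable_def by blast
  show ?thesis
    using partial_eq_derivative[OF has_derivative_add[OF d]] partial_eq_derivative[OF d(1)]
      partial_eq_derivative[OF d(2)] by simp
qed

lemma partial_mult:
  assumes "f differentiable (at x)" "g differentiable (at x)"
  shows "partial i (\<lambda>y. f y * g y) x = f x * partial i g x + partial i f x * g x"
proof -
  obtain f' g' where d: "(f has_derivative f') (at x)" "(g has_derivative g') (at x)"
    using assms unfolding differentiable_def by blast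
  show ?thesis
    using partial_eq_derivative[OF has_derivative_mult[OF d]] partial_eq_derivative[OF d(1)]
      partial_eq_derivative[OF d(2)] by simp
qed

lemma partial_const: "partial i (\<lambda>y. c) x = 0"
  unfolding partial_def by simp

lemma partial_cmult:
  assumes "f differentiable (at x)"
  shows "partial i (\<lambda>y. c * f y) x = c * partial i f x"
  using partial_mult[of "\<lambda>y. c" x f i] assms by (simp add: partial_const)

lemma chain_has_derivative:
  fixes f :: "'a::real_normed_vector \<Rightarrow> real"
  assumes "(g has_real_derivative g') (at (f x))" "(f has_derivative f') (at x)"
  shows "((\<lambda>y. g (f y)) has_derivative (\<lambda>v. g' * f' v)) (at x)"
  using has_derivative_compose[OF assms(2)] assms(1) unfolding has_field_derivative_def by blast

lemma differentiable_chain: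
  fixes f :: "'a::real_normed_vector \<Rightarrow> real"
  assumes "(g has_real_derivative g') (at (f x))" "f differentiable (at x)"
  shows "(\<lambda>y. g (f y)) differentiable (at x)"
  using assms chain_has_derivative unfolding differentiable_def by blast

lemma partial_chain:
  assumes "(g has_real_derivative g') (at (f x))" "f differentiable (at x)"
  shows "partial i (\<lambda>y. g (f y)) x = g' * partial i f x"
proof -
  obtain f' where d: "(f has_derivative f') (at x)"
    using assms(2) unfolding differentiable_def by blast
  show ?thesis
    using partial_eq_derivative[OF chain_has_derivative[where g=g and g'=g', OF assms(1) d]]
      partial_eq_derivative[OF d] by simp
qed

lemma differentiable_component:
  fixes V :: "real^3 \<Rightarrow> real^3"
  assumes "V differentiable (at x)"
  shows "(\<lambda>y. V y $ i) differentiable (at x)"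
  using assms bounded_linear.has_derivative[OF bounded_linear_vec_nth]
  unfolding differentiable_def by blast

lemma divg_scaleR:
  assumes "\<phi> differentiable (at x)" "W differentiable (at x)"
  shows "divg (\<lambda>y. \<phi> y *\<^sub>R W y) x = \<phi> x * divg W x + transport W \<phi> x"
  unfolding divg_def transport_def
  by (simp add: partial_mult assms differentiable_component sum.distrib sum_distrib_left mult.commute)

lemma transport_chain:
  assumes "(g has_real_derivative g') (at (f x))" "f differentiable (at x)"
  shows "transport u (\<lambda>y. g (f y)) x = g' * transport u f x"
  unfolding transport_def partial_chain[where g=g, OF assms]
  by (simp add: sum_distrib_left mult.left_commute)

section \<open>Closed forms for a power law\<close>

text \<open>
  The two pressure laws differ only in the constant in front of the power: it is \<open>1/\<gamma>\<close> in the
  isentropic case and \<open>a(S)\<close> at a frozen entropy.  One family covers both.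
\<close>

definition power_law :: "real \<Rightarrow> real \<Rightarrow> real \<Rightarrow> real" where
  "power_law k \<gamma> = (\<lambda>\<rho>. k * \<rho> powr \<gamma>)"

lemma isentropic_law_eq: "isentropic_law \<gamma> = power_law (1 / \<gamma>) \<gamma>"
  by (simp add: isentropic_law_def power_law_def)

lemma polytropic_law_eq: "polytropic_law \<gamma> a S = power_law (a S) \<gamma>"
  by (simp add: polytropic_law_def power_law_def)

lemma power_law_deriv:
  "0 < t \<Longrightarrow> (power_law k \<gamma> has_real_derivative k * \<gamma> * t powr (\<gamma> - 1)) (at t)"
  unfolding power_law_def by (auto intro!: derivative_eq_intros)

lemma sound2_power_law: "0 < t \<Longrightarrow> sound2 (power_law k \<gamma>) t = k * \<gamma> * t powr (\<gamma> - 1)"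
  unfolding sound2_def by (rule DERIV_imp_deriv[OF power_law_deriv])

definition power_enthalpy :: "real \<Rightarrow> real \<Rightarrow> real \<Rightarrow> real" where
  "power_enthalpy k \<gamma> \<rho> = k * \<gamma> / (\<gamma> - 1) * \<rho> powr (\<gamma> - 1)"

lemma power_enthalpy_deriv:
  assumes "1 < \<gamma>" "0 < t"
  shows "(power_enthalpy k \<gamma> has_real_derivative sound2 (power_law k \<gamma>) t / t) (at t)"
proof -
  have "(power_enthalpy k \<gamma> has_real_derivative
          k * \<gamma> / (\<gamma> - 1) * ((\<gamma> - 1) * t powr (\<gamma> - 1 - 1))) (at t)"
    unfolding power_enthalpy_def using assms
    by (intro DERIV_cmult has_real_derivative_powr) auto
  moreover have "k * \<gamma> / (\<gamma> - 1) * ((\<gamma> - 1) * t powr (\<gamma> - 1 - 1)) = sound2 (power_law k \<gamma>) t / t"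
    using assms by (simp add: sound2_power_law powr_diff power2_eq_square)
  ultimately show ?thesis by simp
qed

lemma power_enthalpy_continuous: "1 < \<gamma> \<Longrightarrow> continuous_on {0..r} (power_enthalpy k \<gamma>)"
  unfolding power_enthalpy_def by (intro continuous_intros continuous_on_powr') auto

lemma power_enthalpy_mono:
  assumes "1 < \<gamma>" "0 \<le> k" "0 \<le> s" "s \<le> t"
  shows "power_enthalpy k \<gamma> s \<le> power_enthalpy k \<gamma> t"
  unfolding power_enthalpy_def using assms by (intro mult_left_mono powr_mono2) auto

lemma power_enthalpy_0: "power_enthalpy k \<gamma> 0 = 0"
  by (simp add: power_enthalpy_def)

lemma enthalpy_power_law:
  assumes "1 < \<gamma>" "0 \<le> \<rho>"
  shows "enthalpy (power_law k \<gamma>) \<rho> = power_enthalpy k \<gamma> \<rho>"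
proof -
  have "((\<lambda>t. sound2 (power_law k \<gamma>) t / t) has_integral
          (power_enthalpy k \<gamma> \<rho> - power_enthalpy k \<gamma> 0)) {0..\<rho>}"
  proof (rule fundamental_theorem_of_calculus_interior)
    show "continuous_on {0..\<rho>} (power_enthalpy k \<gamma>)"
      using assms by (rule_tac power_enthalpy_continuous)
    fix t assume t: "t \<in> {0<..<\<rho>}"
    show "(power_enthalpy k \<gamma> has_vector_derivative sound2 (power_law k \<gamma>) t / t) (at t)"
      using power_enthalpy_deriv[of \<gamma> t] assms t
      by (simp add: has_real_derivative_iff_has_vector_derivative)
  qed (use assms in auto)
  then show ?thesis
    unfolding enthalpy_def by (simp add: integral_unique power_enthalpy_0)
qed

text \<open>
  Since \<open>h' = c\<^sup>2/t\<close>, the exponent is the integral of \<open>h'/(2(B - h))\<close>, whose primitive is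
  \<open>- 1/2 ln (B - h)\<close>.  This primitive is continuous up to \<open>t = 0\<close>, and so the fundamental theorem
  applies although the integrand may be singular there.  The condition \<open>h(\<rho>) < B\<close> keeps the
  logarithm finite on the whole interval because \<open>h\<close> increases.
\<close>

lemma I_factor_power_law:
  assumes "1 < \<gamma>" "0 \<le> k" "0 \<le> \<rho>" "power_enthalpy k \<gamma> \<rho> < B"
  shows "I_factor (power_law k \<gamma>) B \<rho> = sqrt (B / (B - power_enthalpy k \<gamma> \<rho>))"
proof -
  let ?h = "power_enthalpy k \<gamma>"
  let ?F = "\<lambda>t. - (1/2) * ln (B - ?h t)"
  have below: "?h t < B" if "0 \<le> t" "t \<le> \<rho>" for t
    using power_enthalpy_mono[of \<gamma> k t \<rho>] assms that by linarith
  have B: "0 < B"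
    using below[of 0] assms by (simp add: power_enthalpy_0)
  have "((\<lambda>t. sound2 (power_law k \<gamma>) t / (2 * t * (B - enthalpy (power_law k \<gamma>) t)))
          has_integral (?F \<rho> - ?F 0)) {0..\<rho>}"
  proof (rule fundamental_theorem_of_calculus_interior)
    show "continuous_on {0..\<rho>} ?F"
      using assms below by (intro continuous_intros power_enthalpy_continuous) force+
    fix t assume t: "t \<in> {0<..<\<rho>}"
    have "(?F has_real_derivative
            - (1/2) * (inverse (B - ?h t) * (0 - sound2 (power_law k \<gamma>) t / t))) (at t)"
      using below[of t] t assms
      by (intro DERIV_cmult DERIV_chain2[of ln] DERIV_ln DERIV_diff DERIV_const
            power_enthalpy_deriv) auto
    moreover have "- (1/2) * (inverse (B - ?h t) * (0 - sound2 (power_law k \<gamma>) t / t)) =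
        sound2 (power_law k \<gamma>) t / (2 * t * (B - enthalpy (power_law k \<gamma>) t))"
      using below[of t] t assms by (simp add: enthalpy_power_law field_simps)
    ultimately show "(?F has_vector_derivative
        sound2 (power_law k \<gamma>) t / (2 * t * (B - enthalpy (power_law k \<gamma>) t))) (at t)"
      by (simp add: has_real_derivative_iff_has_vector_derivative)
  qed (use assms in auto)
  then have "I_factor (power_law k \<gamma>) B \<rho> = exp (?F \<rho> - ?F 0)"
    unfolding I_factor_def by (simp only: integral_unique)
  also have "?F \<rho> - ?F 0 = 1/2 * ln (B / (B - ?h \<rho>))"
    using assms B by (simp add: power_enthalpy_0 ln_div)
  also have "exp \<dots> = sqrt (B / (B - ?h \<rho>))"
    using assms B by (simp add: powr_half_sqrt[symmetric] powr_def)
  finally show ?thesis .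
qed

text \<open>
  By the closed form of \<open>I\<close>, the factor \<open>I\<^sup>-\<^sup>2 = (B - h)/B\<close> cancels the denominator \<open>B - h\<close>
  and leaves the integrand \<open>c\<^sup>2/(2B) = P'/(2B)\<close>.
\<close>

lemma Q_pressure_power_law:
  assumes "1 < \<gamma>" "0 \<le> k" "0 \<le> \<rho>" "power_enthalpy k \<gamma> \<rho> < B"
  shows "Q_pressure (power_law k \<gamma>) B \<rho> = 1 / (2 * B) * power_law k \<gamma> \<rho>"
proof -
  let ?h = "power_enthalpy k \<gamma>" and ?P = "power_law k \<gamma>"
  let ?F = "\<lambda>t. 1 / (2 * B) * ?P t"
  have below: "?h t < B" if "0 \<le> t" "t \<le> \<rho>" for t
    using power_enthalpy_mono[of \<gamma> k t \<rho>] assms that by linarith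
  have B: "0 < B"
    using below[of 0] assms by (simp add: power_enthalpy_0)
  have "((\<lambda>t. sound2 ?P t / (2 * (B - enthalpy ?P t)) * (I_factor ?P B t) powi (-2))
          has_integral (?F \<rho> - ?F 0)) {0..\<rho>}"
  proof (rule fundamental_theorem_of_calculus_interior)
    show "continuous_on {0..\<rho>} ?F"
      unfolding power_law_def using assms by (intro continuous_intros continuous_on_powr') auto
    fix t assume t: "t \<in> {0<..<\<rho>}"
    have I: "(I_factor ?P B t) powi (-2) = (B - ?h t) / B"
      using below[of t] t assms B by (simp add: I_factor_power_law power_int_minus)
    have "(?F has_real_derivative 1 / (2 * B) * sound2 ?P t) (at t)"
      using t by (intro DERIV_cmult) (simp add: sound2_power_law power_law_deriv)
    moreover have "1 / (2 * B) * sound2 ?P t =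
        sound2 ?P t / (2 * (B - enthalpy ?P t)) * (I_factor ?P B t) powi (-2)"
      unfolding I using below[of t] t assms B by (simp add: enthalpy_power_law field_simps)
    ultimately show "(?F has_vector_derivative
        sound2 ?P t / (2 * (B - enthalpy ?P t)) * (I_factor ?P B t) powi (-2)) (at t)"
      by (simp add: has_real_derivative_iff_has_vector_derivative)
  qed (use assms in auto)
  then have "Q_pressure ?P B \<rho> = ?F \<rho> - ?F 0"
    unfolding Q_pressure_def by (rule integral_unique)
  then show ?thesis
    by (simp add: power_law_def)
qed

section \<open>The rescaled velocity\<close>

lemma K_dir_eq:
  assumes "0 < v $ 1"
  shows "K_dir v = (1 / norm v) *\<^sub>R v"
proof -
  have n: "norm v = sqrt ((v$1)\<^sup>2 + (v$2)\<^sup>2 + (v$3)\<^sup>2)"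
    by (simp add: norm_vec_def L2_set_def sum_3)
  have "v \<noteq> 0" using assms by auto
  then have pos: "0 < norm v" by simp
  have G: "G_factor v = (norm v / v$1)\<^sup>2"
    unfolding G_factor_def n using assms by (simp add: power_divide field_simps)
  have "G_factor v powr (-1/2) = v$1 / norm v"
    using assms pos unfolding G by (simp add: powr_minus powr_half_sqrt real_sqrt_divide inverse_eq_divide)
  then show ?thesis
    using assms by (simp add: vec_eq_iff forall_3 K_dir_def)
qed

lemma bernoulli_power_law:
  "\<lbrakk>1 < \<gamma>; 0 \<le> \<rho>\<rbrakk> \<Longrightarrow> bernoulli (power_law k \<gamma>) \<rho> v = 1/2 * (norm v)\<^sup>2 + power_enthalpy k \<gamma> \<rho>"
  by (simp add: bernoulli_def enthalpy_power_law)

lemma power_enthalpy_less_bernoulli: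
  assumes "1 < \<gamma>" "0 \<le> \<rho>" "v \<noteq> 0"
  shows "power_enthalpy k \<gamma> \<rho> < bernoulli (power_law k \<gamma>) \<rho> v"
  using assms by (simp add: bernoulli_power_law)

lemma bernoulli_pos:
  assumes "1 < \<gamma>" "0 \<le> k" "0 \<le> \<rho>" "v \<noteq> 0"
  shows "0 < bernoulli (power_law k \<gamma>) \<rho> v"
  using power_enthalpy_less_bernoulli[of \<gamma> \<rho> v k] power_enthalpy_mono[of \<gamma> k 0 \<rho>] assms
  by (simp add: power_enthalpy_0)

text \<open>
  The closed form of \<open>I\<close> contains \<open>B - h\<close>, which is the kinetic energy \<open>|v|\<^sup>2/2\<close>.  Hence
  \<open>I = sqrt (2B) / |v|\<close>, and the factor \<open>|v|\<close> turns the direction \<open>K = v/|v|\<close> back into \<open>v\<close>.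
\<close>

lemma K_over_I:
  assumes "1 < \<gamma>" "0 \<le> k" "0 \<le> \<rho>" "0 < v $ 1"
    and B: "B = bernoulli (power_law k \<gamma>) \<rho> v"
  shows "(1 / I_factor (power_law k \<gamma>) B \<rho>) *\<^sub>R K_dir v = (1 / sqrt (2 * B)) *\<^sub>R v"
proof -
  have v: "v \<noteq> 0" using assms(4) by auto
  have Bpos: "0 < B" using bernoulli_pos v assms by blast
  have kinetic: "B - power_enthalpy k \<gamma> \<rho> = (norm v)\<^sup>2 / 2"
    using assms by (simp add: bernoulli_power_law)
  have "sqrt (B - power_enthalpy k \<gamma> \<rho>) = norm v / sqrt 2"
    unfolding kinetic by (simp add: real_sqrt_divide)
  then have "I_factor (power_law k \<gamma>) B \<rho> = sqrt (2 * B) / norm v"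
    using I_factor_power_law[of \<gamma> k \<rho> B] power_enthalpy_less_bernoulli[of \<gamma> \<rho> v k] v assms(1,2,3)
    unfolding B by (simp add: real_sqrt_divide real_sqrt_mult mult.commute)
  then show ?thesis
    using v Bpos by (simp add: K_dir_eq[OF assms(4)])
qed

section \<open>Flows\<close>

lemma bernoulli_power_law_differentiable:
  fixes u :: "real^3 \<Rightarrow> real^3"
  assumes "1 < \<gamma>" "open \<Omega>" "x \<in> \<Omega>" "\<And>y. y \<in> \<Omega> \<Longrightarrow> 0 < \<rho> y"
    and "k differentiable (at x)" "\<rho> differentiable (at x)" "u differentiable (at x)"
  shows "(\<lambda>y. bernoulli (power_law (k y) \<gamma>) (\<rho> y) (u y)) differentiable (at x)"
proof (rule differentiable_cong_open[OF assms(2,3)])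
  show "bernoulli (power_law (k y) \<gamma>) (\<rho> y) (u y) =
      1/2 * (u y \<bullet> u y) + \<gamma> / (\<gamma> - 1) * (k y * \<rho> y powr (\<gamma> - 1))" if "y \<in> \<Omega>" for y
    using assms(1) assms(4)[OF that]
    by (simp add: bernoulli_power_law power_enthalpy_def power2_norm_eq_inner)
  have "(\<lambda>y. \<rho> y powr (\<gamma> - 1)) differentiable (at x)"
    by (rule differentiable_chain[where f=\<rho>, OF has_real_derivative_powr]) (use assms in auto)
  then show "(\<lambda>y. 1/2 * (u y \<bullet> u y) + \<gamma> / (\<gamma> - 1) * (k y * \<rho> y powr (\<gamma> - 1))) differentiable (at x)"
    using assms by (intro derivative_intros differentiable_inner) auto
qed

text \<open>
  The \<open>i\<close>-th momentum flux is \<open>u\<^sub>i\<close> times the mass flux, and the mass flux is divergence free.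
\<close>

lemma momentum_transport_form:
  fixes u :: "real^3 \<Rightarrow> real^3"
  assumes "\<rho> differentiable (at x)" "u differentiable (at x)"
    and "divg (\<lambda>y. \<rho> y *\<^sub>R u y) x = 0"
  shows "(\<Sum>j\<in>UNIV. partial j (\<lambda>y. \<rho> y * u y $ i * u y $ j) x) = \<rho> x * transport u (\<lambda>y. u y $ i) x"
proof -
  note d = assms(1) differentiable_component[OF assms(2)]
  have "partial j (\<lambda>y. \<rho> y * u y $ i * u y $ j) x =
      u x $ i * partial j (\<lambda>y. \<rho> y * u y $ j) x + \<rho> x * (u x $ j * partial j (\<lambda>y. u y $ i) x)" for j
    using d by (simp add: partial_mult algebra_simps)
  then show ?thesis
    using assms(3) unfolding divg_def transport_def
    by (simp add: sum.distrib sum_distrib_left[symmetric])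
qed

text \<open>
  Bernoulli's theorem.  Taking the inner product of the momentum equation with \<open>u\<close> gives
  \<open>\<rho> (u \<cdot> \<nabla>)(|u|\<^sup>2/2) + u \<cdot> \<nabla>p = 0\<close>, and \<open>\<nabla>p = \<rho> \<nabla>h\<close> because \<open>h' = P'/\<rho>\<close> and
  \<open>k\<close> is constant in space.
\<close>

lemma bernoulli_transported:
  fixes u :: "real^3 \<Rightarrow> real^3"
  assumes "1 < \<gamma>" "open \<Omega>" "x \<in> \<Omega>" "\<And>y. y \<in> \<Omega> \<Longrightarrow> 0 < \<rho> y"
    and d: "\<rho> differentiable (at x)" "u differentiable (at x)"
    and mom: "\<And>i. \<rho> x * transport u (\<lambda>y. u y $ i) x + partial i (\<lambda>y. power_law k \<gamma> (\<rho> y)) x = 0"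
  shows "transport u (\<lambda>y. bernoulli (power_law k \<gamma>) (\<rho> y) (u y)) x = 0"
proof -
  note du = differentiable_component[OF d(2)]
  define c where "c = sound2 (power_law k \<gamma>) (\<rho> x)"
  have \<rho>: "0 < \<rho> x" using assms by blast
  have dp: "partial i (\<lambda>y. power_law k \<gamma> (\<rho> y)) x = c * partial i \<rho> x" for i
    unfolding c_def sound2_power_law[OF \<rho>] by (rule partial_chain[OF power_law_deriv[OF \<rho>] d(1)])
  have dh: "partial i (\<lambda>y. power_enthalpy k \<gamma> (\<rho> y)) x = c / \<rho> x * partial i \<rho> x" for i
    unfolding c_def by (rule partial_chain[OF power_enthalpy_deriv[OF assms(1) \<rho>] d(1)])
  have dh': "(\<lambda>y. power_enthalpy k \<gamma> (\<rho> y)) differentiable (at x)"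
    by (rule differentiable_chain[OF power_enthalpy_deriv[OF assms(1) \<rho>] d(1)])
  have dB: "partial j (\<lambda>y. bernoulli (power_law k \<gamma>) (\<rho> y) (u y)) x =
      (\<Sum>i\<in>UNIV. u x $ i * partial j (\<lambda>y. u y $ i) x) + c / \<rho> x * partial j \<rho> x" for j
  proof -
    have "partial j (\<lambda>y. bernoulli (power_law k \<gamma>) (\<rho> y) (u y)) x =
        partial j (\<lambda>y. 1/2 * (u y $ 1 * u y $ 1 + u y $ 2 * u y $ 2 + u y $ 3 * u y $ 3)
                       + power_enthalpy k \<gamma> (\<rho> y)) x"
      using assms(1,4)
      by (intro partial_cong[OF assms(2,3)])
        (simp add: bernoulli_power_law less_imp_le power2_norm_eq_inner inner_vec_def sum_3)
    also have "\<dots> = 1/2 * partial j (\<lambda>y. u y $ 1 * u y $ 1 + u y $ 2 * u y $ 2 + u y $ 3 * u y $ 3) x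
        + c / \<rho> x * partial j \<rho> x"
      using du dh' by (subst partial_add, simp, simp, subst partial_cmult) (auto simp: dh)
    also have "\<dots> = (\<Sum>i\<in>UNIV. u x $ i * partial j (\<lambda>y. u y $ i) x) + c / \<rho> x * partial j \<rho> x"
      using du by (simp add: partial_add partial_mult sum_3)
    finally show ?thesis .
  qed
  \<comment> \<open>The inner product of the momentum equation with the velocity.\<close>
  have "\<rho> x * transport u (\<lambda>y. bernoulli (power_law k \<gamma>) (\<rho> y) (u y)) x =
      (\<Sum>i\<in>UNIV. u x $ i * (\<rho> x * transport u (\<lambda>y. u y $ i) x + c * partial i \<rho> x))"
    using \<rho> unfolding transport_def dB by (simp add: sum_3 field_simps)
  also have "\<dots> = 0"
    using mom unfolding dp by simp
  finally show ?thesis using \<rho> by simp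
qed

text \<open>
  The field is \<open>\<phi> \<rho> u\<close> with \<open>\<phi> = 1/sqrt (2B)\<close>.  Its divergence is
  \<open>\<phi> div (\<rho> u) + \<rho> u \<cdot> \<nabla>\<phi>\<close>.  The first term vanishes by conservation of mass, the second one because
  \<open>\<phi>\<close> is a function of the transported quantity \<open>B\<close>.  The coefficient \<open>k\<close> may vary in space here,
  which is what a variable entropy requires.
\<close>

lemma divergence_free_rescaled_momentum:
  fixes u :: "real^3 \<Rightarrow> real^3" and k :: "real^3 \<Rightarrow> real" and \<rho> :: "real^3 \<Rightarrow> real" and \<gamma> :: real
  defines "B \<equiv> \<lambda>x. bernoulli (power_law (k x) \<gamma>) (\<rho> x) (u x)"
  assumes \<gamma>: "1 < \<gamma>" and \<Omega>: "open \<Omega>" and nd: "nondegenerate \<Omega> \<rho> u"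
    and k: "\<And>x. x \<in> \<Omega> \<Longrightarrow> 0 \<le> k x"
    and dk: "\<And>x. x \<in> \<Omega> \<Longrightarrow> k differentiable (at x)"
    and d\<rho>: "\<And>x. x \<in> \<Omega> \<Longrightarrow> \<rho> differentiable (at x)"
    and du: "\<And>x. x \<in> \<Omega> \<Longrightarrow> u differentiable (at x)"
    and mass: "\<And>x. x \<in> \<Omega> \<Longrightarrow> divg (\<lambda>y. \<rho> y *\<^sub>R u y) x = 0"
    and trans: "\<And>x. x \<in> \<Omega> \<Longrightarrow> transport u (B) x = 0"
  shows "divergence_free_on \<Omega>
    (\<lambda>x. (\<rho> x / I_factor (power_law (k x) \<gamma>) (B x) (\<rho> x)) *\<^sub>R K_dir (u x))"
proof -
  let ?V = "\<lambda>x. (\<rho> x / I_factor (power_law (k x) \<gamma>) (B x) (\<rho> x)) *\<^sub>R K_dir (u x)"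
  let ?\<phi> = "\<lambda>x. 1 / sqrt (2 * B x)"
  let ?W = "\<lambda>x. ?\<phi> x *\<^sub>R (\<rho> x *\<^sub>R u x)"
  have \<rho>: "0 < \<rho> x" and u1: "0 < u x $ 1" if "x \<in> \<Omega>" for x
    using nd that unfolding nondegenerate_def by auto
  have Bpos: "0 < B x" if "x \<in> \<Omega>" for x
    unfolding B_def using \<gamma> k[OF that] \<rho>[OF that] u1[OF that] by (intro bernoulli_pos) auto
  have eq: "?V x = ?W x" if "x \<in> \<Omega>" for x
  proof -
    have "?V x = \<rho> x *\<^sub>R ((1 / I_factor (power_law (k x) \<gamma>) (B x) (\<rho> x)) *\<^sub>R K_dir (u x))"
      by simp
    also have "\<dots> = \<rho> x *\<^sub>R (?\<phi> x *\<^sub>R u x)"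
      using K_over_I[OF \<gamma> k[OF that] less_imp_le[OF \<rho>[OF that]] u1[OF that]] unfolding B_def by simp
    finally show ?thesis by (simp add: mult.commute)
  qed
  have "?V differentiable (at x) \<and> divg ?V x = 0" if x: "x \<in> \<Omega>" for x
  proof -
    have dB: "B differentiable (at x)"
      unfolding B_def by (rule bernoulli_power_law_differentiable[OF \<gamma> \<Omega> x \<rho> dk[OF x] d\<rho>[OF x] du[OF x]])
    have g: "((\<lambda>b. 1 / sqrt (2 * b)) has_real_derivative
        - (inverse (sqrt (2 * B x)) / 2 * 2) / (sqrt (2 * B x))\<^sup>2) (at (B x))"
      using Bpos[OF x] by (auto intro!: derivative_eq_intros simp: power2_eq_square)
    have d\<phi>: "?\<phi> differentiable (at x)"
      by (rule differentiable_chain[OF g dB])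
    have d\<rho>u: "(\<lambda>y. \<rho> y *\<^sub>R u y) differentiable (at x)"
      using d\<rho> du x by (intro derivative_intros) auto
    have "transport (\<lambda>y. \<rho> y *\<^sub>R u y) ?\<phi> x = \<rho> x * transport u ?\<phi> x"
      by (simp add: transport_def sum_distrib_left mult.assoc)
    also have "transport u ?\<phi> x = 0"
      using transport_chain[OF g dB] trans[OF x] by simp
    finally have "divg ?W x = 0"
      using divg_scaleR[OF d\<phi> d\<rho>u] mass[OF x] by simp
    moreover have "?W differentiable (at x)"
      using d\<phi> d\<rho>u by (rule differentiable_scaleR)
    ultimately show ?thesis
      using differentiable_cong_open[OF \<Omega> x eq] divg_cong[OF \<Omega> x eq] by simp
  qed
  then show ?thesis
    using \<Omega> by (simp add: divergence_free_on_def differentiable_on_eq_differentiable_at)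
qed

text \<open>
  Mass flux is linear and momentum flux quadratic in the velocity, so the system survives the
  multiplication of velocity by \<open>c\<close> and of pressure by \<open>c\<^sup>2\<close>.  With a constant Bernoulli function,
  this applies to \<open>c = 1/sqrt (2B)\<close>.
\<close>

lemma steady_euler_scale:
  fixes u :: "real^3 \<Rightarrow> real^3"
  assumes "steady_euler \<Omega> \<rho> u p"
    and d: "\<And>x. x \<in> \<Omega> \<Longrightarrow> \<rho> differentiable (at x)"
      "\<And>x. x \<in> \<Omega> \<Longrightarrow> u differentiable (at x)"
      "\<And>x. x \<in> \<Omega> \<Longrightarrow> p differentiable (at x)"
  shows "steady_euler \<Omega> \<rho> (\<lambda>x. c *\<^sub>R u x) (\<lambda>x. c\<^sup>2 * p x)"
  unfolding steady_euler_def
proof (intro ballI conjI allI)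
  fix x i assume x: "x \<in> \<Omega>"
  note dx = d(1)[OF x] differentiable_component[OF d(2)[OF x]] d(3)[OF x]
  have "divg (\<lambda>y. \<rho> y *\<^sub>R c *\<^sub>R u y) x = divg (\<lambda>y. c *\<^sub>R \<rho> y *\<^sub>R u y) x"
    by (simp add: mult.commute)
  also have "\<dots> = c * divg (\<lambda>y. \<rho> y *\<^sub>R u y) x"
    using dx unfolding divg_def by (simp add: partial_cmult sum_distrib_left mult.assoc)
  finally show "divg (\<lambda>y. \<rho> y *\<^sub>R c *\<^sub>R u y) x = 0"
    using assms(1) x by (simp add: steady_euler_def)
  have "partial j (\<lambda>y. \<rho> y * (c *\<^sub>R u y) $ i * (c *\<^sub>R u y) $ j) x =
      c\<^sup>2 * partial j (\<lambda>y. \<rho> y * u y $ i * u y $ j) x" for j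
  proof -
    have "(\<lambda>y. \<rho> y * (c *\<^sub>R u y) $ i * (c *\<^sub>R u y) $ j) =
        (\<lambda>y. c\<^sup>2 * (\<rho> y * u y $ i * u y $ j))"
      by (auto simp: power2_eq_square)
    then show ?thesis
      using dx by (simp add: partial_cmult)
  qed
  then have "(\<Sum>j\<in>UNIV. partial j (\<lambda>y. \<rho> y * (c *\<^sub>R u y) $ i * (c *\<^sub>R u y) $ j) x) +
        partial i (\<lambda>y. c\<^sup>2 * p y) x =
      c\<^sup>2 * ((\<Sum>j\<in>UNIV. partial j (\<lambda>y. \<rho> y * u y $ i * u y $ j) x) + partial i p x)"
    using dx by (simp add: partial_cmult sum_distrib_left distrib_left)
  then show "(\<Sum>j\<in>UNIV. partial j (\<lambda>y. \<rho> y * (c *\<^sub>R u y) $ i * (c *\<^sub>R u y) $ j) x) +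
        partial i (\<lambda>y. c\<^sup>2 * p y) x = 0"
    using assms(1) x by (simp add: steady_euler_def)
qed

lemma steady_euler_cong:
  assumes "open \<Omega>" "\<And>y. y \<in> \<Omega> \<Longrightarrow> u y = v y" "\<And>y. y \<in> \<Omega> \<Longrightarrow> p y = q y"
    and "steady_euler \<Omega> \<rho> v q"
  shows "steady_euler \<Omega> \<rho> u p"
proof -
  have "divg (\<lambda>y. \<rho> y *\<^sub>R u y) x = divg (\<lambda>y. \<rho> y *\<^sub>R v y) x"
    "partial i p x = partial i q x"
    "partial j (\<lambda>y. \<rho> y * u y $ i * u y $ j) x = partial j (\<lambda>y. \<rho> y * v y $ i * v y $ j) x"
    if "x \<in> \<Omega>" for x i j
    using assms(2,3) that by (auto intro!: divg_cong[OF assms(1)] partial_cong[OF assms(1)])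
  then show ?thesis
    using assms(4) unfolding steady_euler_def by simp
qed

theorem theorem3p5:
  fixes \<gamma> :: real and \<Omega> :: "(real^3) set"
  assumes "1 < \<gamma>" and "\<gamma> < 3" and "open \<Omega>"
  shows
    "(\<forall>(\<rho> :: real^3 \<Rightarrow> real) (u :: real^3 \<Rightarrow> real^3) (B :: real).
        isentropic_flow \<gamma> \<Omega> \<rho> u \<and> nondegenerate \<Omega> \<rho> u \<and>
        (\<forall>x\<in>\<Omega>. bernoulli (isentropic_law \<gamma>) (\<rho> x) (u x) = B) \<longrightarrow>
        (let A = (\<lambda>x. (1 / I_factor (isentropic_law \<gamma>) B (\<rho> x)) *\<^sub>R K_dir (u x));
             Q = (\<lambda>x. Q_pressure (isentropic_law \<gamma>) B (\<rho> x))
         in A differentiable_on \<Omega> \<and> Q differentiable_on \<Omega> \<and> steady_euler \<Omega> \<rho> A Q))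
     \<and>
     (\<forall>(\<rho> :: real^3 \<Rightarrow> real) (u :: real^3 \<Rightarrow> real^3).
        isentropic_flow \<gamma> \<Omega> \<rho> u \<and> nondegenerate \<Omega> \<rho> u \<longrightarrow>
        (let B = (\<lambda>x. bernoulli (isentropic_law \<gamma>) (\<rho> x) (u x))
         in divergence_free_on \<Omega>
              (\<lambda>x. (\<rho> x / I_factor (isentropic_law \<gamma>) (B x) (\<rho> x)) *\<^sub>R K_dir (u x))))
     \<and>
     (\<forall>(a :: real \<Rightarrow> real) (\<rho> :: real^3 \<Rightarrow> real) (u :: real^3 \<Rightarrow> real^3) (S :: real^3 \<Rightarrow> real).
        smooth_on UNIV a \<and> (\<forall>s. a s > 0) \<and>
        nonisentropic_flow \<gamma> a \<Omega> \<rho> u S \<and> nondegenerate \<Omega> \<rho> u \<longrightarrow>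
        (let B = (\<lambda>x. bernoulli (polytropic_law \<gamma> a (S x)) (\<rho> x) (u x))
         in divergence_free_on \<Omega>
              (\<lambda>x. (\<rho> x / I_factor (polytropic_law \<gamma> a (S x)) (B x) (\<rho> x)) *\<^sub>R K_dir (u x))))"
proof (intro conjI allI impI)
  fix \<rho> :: "real^3 \<Rightarrow> real" and u :: "real^3 \<Rightarrow> real^3" and B :: real
  assume *: "isentropic_flow \<gamma> \<Omega> \<rho> u \<and> nondegenerate \<Omega> \<rho> u \<and>
      (\<forall>x\<in>\<Omega>. bernoulli (isentropic_law \<gamma>) (\<rho> x) (u x) = B)"
  let ?P = "isentropic_law \<gamma>"
  let ?A = "\<lambda>x. (1 / I_factor ?P B (\<rho> x)) *\<^sub>R K_dir (u x)"
  let ?Q = "\<lambda>x. Q_pressure ?P B (\<rho> x)"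
  define c where "c = 1 / sqrt (2 * B)"
  have d\<rho>: "\<rho> differentiable (at x)" and du: "u differentiable (at x)" if "x \<in> \<Omega>" for x
    using * that smooth_on_imp_differentiable_at[OF _ \<open>open \<Omega>\<close>] unfolding isentropic_flow_def by auto
  have \<rho>: "0 < \<rho> x" and u1: "0 < u x $ 1"
    and B: "B = bernoulli (power_law (1 / \<gamma>) \<gamma>) (\<rho> x) (u x)" if "x \<in> \<Omega>" for x
    using * that unfolding nondegenerate_def isentropic_law_eq by auto
  have A: "?A x = c *\<^sub>R u x" if "x \<in> \<Omega>" for x
    unfolding c_def isentropic_law_eq
    using K_over_I[OF \<open>1 < \<gamma>\<close> _ _ u1[OF that] B[OF that]] \<rho>[OF that] \<open>1 < \<gamma>\<close> by simp
  have Q: "?Q x = c\<^sup>2 * ?P (\<rho> x)" if "x \<in> \<Omega>" for x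
  proof -
    have u0: "u x \<noteq> 0" using u1[OF that] by auto
    have "0 < B"
      unfolding B[OF that] using \<open>1 < \<gamma>\<close> \<rho>[OF that] u0 by (intro bernoulli_pos) auto
    then have "c\<^sup>2 = 1 / (2 * B)"
      by (simp add: c_def power_divide)
    moreover have "power_enthalpy (1 / \<gamma>) \<gamma> (\<rho> x) < B"
      unfolding B[OF that] using \<open>1 < \<gamma>\<close> \<rho>[OF that] u0
      by (intro power_enthalpy_less_bernoulli) auto
    ultimately show ?thesis
      unfolding isentropic_law_eq using Q_pressure_power_law[of \<gamma> "1 / \<gamma>" "\<rho> x" B] \<open>1 < \<gamma>\<close> \<rho>[OF that]
      by simp
  qed
  have dp: "(\<lambda>y. ?P (\<rho> y)) differentiable (at x)" if "x \<in> \<Omega>" for x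
    unfolding isentropic_law_eq
    by (rule differentiable_chain[OF power_law_deriv[OF \<rho>[OF that]] d\<rho>[OF that]])
  have "?A differentiable (at x)" "?Q differentiable (at x)" if "x \<in> \<Omega>" for x
    using differentiable_cong_open[OF \<open>open \<Omega>\<close> that A] differentiable_cong_open[OF \<open>open \<Omega>\<close> that Q]
      du[OF that] dp[OF that] by simp_all
  then have "?A differentiable_on \<Omega>" "?Q differentiable_on \<Omega>"
    using \<open>open \<Omega>\<close> by (simp_all add: differentiable_on_eq_differentiable_at)
  moreover have "steady_euler \<Omega> \<rho> ?A ?Q"
    using steady_euler_scale[OF _ d\<rho> du dp, of \<Omega> c] *
    by (intro steady_euler_cong[OF \<open>open \<Omega>\<close> A Q]) (auto simp: isentropic_flow_def)
  ultimately show "let A = ?A; Q = ?Q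
      in A differentiable_on \<Omega> \<and> Q differentiable_on \<Omega> \<and> steady_euler \<Omega> \<rho> A Q"
    by simp
next
  fix \<rho> :: "real^3 \<Rightarrow> real" and u :: "real^3 \<Rightarrow> real^3"
  assume *: "isentropic_flow \<gamma> \<Omega> \<rho> u \<and> nondegenerate \<Omega> \<rho> u"
  have d: "\<rho> differentiable (at x)" "u differentiable (at x)" if "x \<in> \<Omega>" for x
    using * that smooth_on_imp_differentiable_at[OF _ \<open>open \<Omega>\<close>] unfolding isentropic_flow_def by auto
  have mass: "divg (\<lambda>y. \<rho> y *\<^sub>R u y) x = 0" if "x \<in> \<Omega>" for x
    using * that unfolding isentropic_flow_def steady_euler_def by auto
  have "\<rho> x * transport u (\<lambda>y. u y $ i) x + partial i (\<lambda>y. power_law (1 / \<gamma>) \<gamma> (\<rho> y)) x = 0"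
    if "x \<in> \<Omega>" for x i
    using * that momentum_transport_form[OF d[OF that] mass[OF that]]
    unfolding isentropic_flow_def steady_euler_def isentropic_law_eq by auto
  then have "transport u (\<lambda>y. bernoulli (power_law (1 / \<gamma>) \<gamma>) (\<rho> y) (u y)) x = 0" if "x \<in> \<Omega>" for x
    using * that d \<open>1 < \<gamma>\<close> \<open>open \<Omega>\<close> unfolding nondegenerate_def
    by (intro bernoulli_transported[where \<Omega> = \<Omega>]) auto
  then show "let B = (\<lambda>x. bernoulli (isentropic_law \<gamma>) (\<rho> x) (u x))
      in divergence_free_on \<Omega>
           (\<lambda>x. (\<rho> x / I_factor (isentropic_law \<gamma>) (B x) (\<rho> x)) *\<^sub>R K_dir (u x))"
    using divergence_free_rescaled_momentum[of \<gamma> \<Omega> \<rho> u "\<lambda>_. 1 / \<gamma>"] * d mass \<open>1 < \<gamma>\<close> \<open>open \<Omega>\<close>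
    by (simp add: isentropic_law_eq)
next
  fix a :: "real \<Rightarrow> real" and \<rho> :: "real^3 \<Rightarrow> real" and u :: "real^3 \<Rightarrow> real^3" and S :: "real^3 \<Rightarrow> real"
  assume *: "smooth_on UNIV a \<and> (\<forall>s. a s > 0) \<and>
      nonisentropic_flow \<gamma> a \<Omega> \<rho> u S \<and> nondegenerate \<Omega> \<rho> u"
  have d: "\<rho> differentiable (at x)" "u differentiable (at x)" "S differentiable (at x)" if "x \<in> \<Omega>" for x
    using * that smooth_on_imp_differentiable_at[OF _ \<open>open \<Omega>\<close>] unfolding nonisentropic_flow_def by auto
  have dk: "(\<lambda>y. a (S y)) differentiable (at x)" if "x \<in> \<Omega>" for x
    using differentiable_chain_at[OF d(3)[OF that], of a] smooth_on_imp_differentiable_at[of UNIV a "S x"] *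
    by (simp add: o_def)
  show "let B = (\<lambda>x. bernoulli (polytropic_law \<gamma> a (S x)) (\<rho> x) (u x))
      in divergence_free_on \<Omega>
           (\<lambda>x. (\<rho> x / I_factor (polytropic_law \<gamma> a (S x)) (B x) (\<rho> x)) *\<^sub>R K_dir (u x))"
    using divergence_free_rescaled_momentum[of \<gamma> \<Omega> \<rho> u "\<lambda>x. a (S x)"] * d dk \<open>1 < \<gamma>\<close> \<open>open \<Omega>\<close>
    by (simp add: polytropic_law_eq nonisentropic_flow_def less_imp_le)
qed

end
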